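(* Let $X=\{\lambda_i\}$ be a finite set, let $\mathbb{Z}X$ be the free Abelian group (written multiplicatively) on $X$, and consider a short exact sequence of groups $$1\longrightarrow \mathbb{Z}X\longrightarrow G\stackrel{\pi}{\longrightarrow} S_n\longrightarrow 1$$ in which the action of $S_n$ on $\mathbb{Z}X$ induced by conjugation in $G$ is a faithful permutation representation (i.e. it is faithful and permutes the basis $X$). Let $\alpha\in G$, let $\theta=\pi(\alpha)^{-1}$ and let $T_\theta\subseteq X$ be a transversal of the action of $\alpha$ on $X$. Then for all integers $a_i$ (one for each $\lambda_i\in X$), the elements $$\prod_{\lambda_i\in X}\lambda_i^{a_i}\,\alpha\qquad\text{and}\qquad \prod_{\lambda_{i_j}\in T_\theta}\lambda_{i_j}^{S_{i_j}}\,\alpha$$ are conjugate in $G$, where $S_{i_j}=\sum_{\lambda_r\in\mathcal{O}_\theta(\lambda_{i_j})}a_r$ for all $\lambda_{i_j}\in T_\theta$.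
   Context: For $g\in G$ with $\varphi=\pi(g)^{-1}$, write $g\lambda_i g^{-1}=\lambda_{\varphi(i)}$ for the action on the basis $X$. "The action of $\alpha$ on $X$" means the action by conjugation of the cyclic group generated by $\alpha$; $\mathcal{O}_\theta(\lambda_i)=\{\lambda_{\theta^k(i)}\mid k\in\mathbb{Z}\}$ is the orbit of $\lambda_i$ under this action, where $\theta=\pi(\alpha)^{-1}$, and a transversal is a set of representatives, one for each orbit. *)

theory Defs
  imports "HOL-Algebra.Sym_Groups" "HOL-Algebra.Free_Abelian_Groups" "HOL-Algebra.Group_Action"
begin

text \<open>
  The group of integral combinations of a set \<open>X\<close> is \<open>free_Abelian_group X\<close>; its basis
  element attached to \<open>i \<in> X\<close> is \<open>frag_of i\<close>.  The set \<open>X\<close> thus serves as its own index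
  set, and in an extension \<open>\<iota> : free_Abelian_group X \<rightarrow> G\<close> the element written
  \<open>\<lambda>\<^sub>i\<close> on paper is \<open>\<iota> (frag_of i)\<close>.
\<close>

text \<open>\<open>exact_seq\<close> of the library requires all groups to live over one type.\<close>

definition short_exact_sequence ::
  "('a, 'm) monoid_scheme \<Rightarrow> ('b, 'k) monoid_scheme \<Rightarrow> ('c, 'l) monoid_scheme
    \<Rightarrow> ('a \<Rightarrow> 'b) \<Rightarrow> ('b \<Rightarrow> 'c) \<Rightarrow> bool" where
  "short_exact_sequence A G Q f p \<longleftrightarrow>
     group A \<and> group G \<and> group Q \<and> f \<in> mon A G \<and> p \<in> epi G Q \<and>
     f ` carrier A = kernel G Q p"

text \<open>
  The action of the quotient on an abelian normal subgroup: \<open>\<sigma>\<close> acts by conjugation with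
  any preimage of \<open>\<sigma>\<close>.  Independence of the preimage is part of
  \<open>induced_action_eq\<close> below.
\<close>

definition induced_action ::
  "('a, 'm) monoid_scheme \<Rightarrow> ('b, 'k) monoid_scheme \<Rightarrow> ('a \<Rightarrow> 'b) \<Rightarrow> ('b \<Rightarrow> 'c)
    \<Rightarrow> 'c \<Rightarrow> 'a \<Rightarrow> 'a" where
  "induced_action A G f p \<sigma> =
     (\<lambda>z \<in> carrier A. THE w. w \<in> carrier A \<and>
        (\<exists>g \<in> carrier G. p g = \<sigma> \<and> f w = g \<otimes>\<^bsub>G\<^esub> f z \<otimes>\<^bsub>G\<^esub> inv\<^bsub>G\<^esub> g))"

text \<open>
  The permutation of the index set \<open>X\<close> attached to \<open>\<phi>\<close> by the rule
  \<open>g \<lambda>\<^sub>i g\<^sup>-\<^sup>1 = \<lambda>\<^bsub>\<phi>(i)\<^esub>\<close> where \<open>\<phi> = p(g)\<^sup>-\<^sup>1\<close>.  Note the inverse.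
\<close>

definition index_perm ::
  "'x set \<Rightarrow> ('b, 'k) monoid_scheme \<Rightarrow> ('c, 'l) monoid_scheme
    \<Rightarrow> (('x \<Rightarrow>\<^sub>0 int) \<Rightarrow> 'b) \<Rightarrow> ('b \<Rightarrow> 'c) \<Rightarrow> 'c \<Rightarrow> 'x \<Rightarrow> 'x" where
  "index_perm X G Q f p \<phi> i =
     (THE j. j \<in> X \<and> (\<exists>g \<in> carrier G. \<phi> = inv\<^bsub>Q\<^esub> (p g) \<and>
        g \<otimes>\<^bsub>G\<^esub> f (frag_of i) \<otimes>\<^bsub>G\<^esub> inv\<^bsub>G\<^esub> g = f (frag_of j)))"

definition index_orbit ::
  "'x set \<Rightarrow> ('b, 'k) monoid_scheme \<Rightarrow> ('c, 'l) monoid_scheme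
    \<Rightarrow> (('x \<Rightarrow>\<^sub>0 int) \<Rightarrow> 'b) \<Rightarrow> ('b \<Rightarrow> 'c) \<Rightarrow> 'c \<Rightarrow> 'x \<Rightarrow> 'x set" where
  "index_orbit X G Q f p \<theta> i = {index_perm X G Q f p (\<theta> [^]\<^bsub>Q\<^esub> k) i | k :: int. True}"

definition transversal :: "'x set \<Rightarrow> ('x \<Rightarrow> 'x set) \<Rightarrow> 'x set \<Rightarrow> bool" where
  "transversal X orb T \<longleftrightarrow> T \<subseteq> X \<and> (\<forall>i \<in> X. \<exists>!t. t \<in> T \<inter> orb i)"

definition conjugate_in :: "('b, 'k) monoid_scheme \<Rightarrow> 'b \<Rightarrow> 'b \<Rightarrow> bool" where
  "conjugate_in G a b \<longleftrightarrow> (\<exists>g \<in> carrier G. g \<otimes>\<^bsub>G\<^esub> a \<otimes>\<^bsub>G\<^esub> inv\<^bsub>G\<^esub> g = b)"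

lemma conj_closed_kernel:
  assumes "short_exact_sequence A G Q f p" "z \<in> carrier A" "g \<in> carrier G"
  shows "\<exists>w \<in> carrier A. f w = g \<otimes>\<^bsub>G\<^esub> f z \<otimes>\<^bsub>G\<^esub> inv\<^bsub>G\<^esub> g"
proof -
  interpret group_hom G Q p
    using assms(1) by (auto simp: short_exact_sequence_def epi_def intro!: group_hom.intro group_hom_axioms.intro)
  have "f z \<in> kernel G Q p" using assms by (auto simp: short_exact_sequence_def)
  then have "g \<otimes>\<^bsub>G\<^esub> f z \<otimes>\<^bsub>G\<^esub> inv\<^bsub>G\<^esub> g \<in> kernel G Q p"
    using assms(3) by (auto simp: kernel_def)
  then show ?thesis using assms(1) unfolding short_exact_sequence_def by (metis imageE)
qed

lemma conj_eq_of_same_image: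
  assumes s: "short_exact_sequence A G Q f p" and ab: "comm_group A"
    and z: "z \<in> carrier A" and g: "g \<in> carrier G" "h \<in> carrier G" "p g = p h"
  shows "g \<otimes>\<^bsub>G\<^esub> f z \<otimes>\<^bsub>G\<^esub> inv\<^bsub>G\<^esub> g = h \<otimes>\<^bsub>G\<^esub> f z \<otimes>\<^bsub>G\<^esub> inv\<^bsub>G\<^esub> h"
proof -
  interpret group_hom G Q p
    using s by (auto simp: short_exact_sequence_def epi_def intro!: group_hom.intro group_hom_axioms.intro)
  interpret A: comm_group A by (rule ab)
  have fh: "f \<in> hom A G" using s by (auto simp: short_exact_sequence_def mon_def)
  have "inv\<^bsub>G\<^esub> h \<otimes>\<^bsub>G\<^esub> g \<in> kernel G Q p" using g by (auto simp: kernel_def)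
  then obtain w where w: "w \<in> carrier A" "f w = inv\<^bsub>G\<^esub> h \<otimes>\<^bsub>G\<^esub> g"
    using s unfolding short_exact_sequence_def by (metis imageE)
  have [simp]: "f z \<in> carrier G" "f w \<in> carrier G" using fh z w(1) by (auto dest: hom_in_carrier)
  have "f w \<otimes>\<^bsub>G\<^esub> f z = f z \<otimes>\<^bsub>G\<^esub> f w"
    by (simp add: Group.hom_mult[OF fh w(1) z, symmetric] Group.hom_mult[OF fh z w(1), symmetric]
        A.m_comm[OF w(1) z])
  then have c: "f w \<otimes>\<^bsub>G\<^esub> f z \<otimes>\<^bsub>G\<^esub> inv\<^bsub>G\<^esub> (f w) = f z"
    by (simp add: G.m_assoc)
  have gw: "g = h \<otimes>\<^bsub>G\<^esub> f w" using w g by (simp add: G.m_assoc[symmetric])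
  have "g \<otimes>\<^bsub>G\<^esub> f z \<otimes>\<^bsub>G\<^esub> inv\<^bsub>G\<^esub> g = h \<otimes>\<^bsub>G\<^esub> (f w \<otimes>\<^bsub>G\<^esub> f z \<otimes>\<^bsub>G\<^esub> inv\<^bsub>G\<^esub> (f w)) \<otimes>\<^bsub>G\<^esub> inv\<^bsub>G\<^esub> h"
    unfolding gw using g by (simp add: G.m_assoc G.inv_mult_group)
  then show ?thesis by (simp only: c)
qed

lemma induced_action_eq:
  assumes s: "short_exact_sequence A G Q f p" and ab: "comm_group A"
    and z: "z \<in> carrier A" and g: "g \<in> carrier G"
  shows "induced_action A G f p (p g) z \<in> carrier A"
    and "f (induced_action A G f p (p g) z) = g \<otimes>\<^bsub>G\<^esub> f z \<otimes>\<^bsub>G\<^esub> inv\<^bsub>G\<^esub> g"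
proof -
  obtain w where w: "w \<in> carrier A" "f w = g \<otimes>\<^bsub>G\<^esub> f z \<otimes>\<^bsub>G\<^esub> inv\<^bsub>G\<^esub> g"
    using conj_closed_kernel[OF s z g] by blast
  have inj: "inj_on f (carrier A)" using s by (auto simp: short_exact_sequence_def mon_def)
  have "induced_action A G f p (p g) z = w"
    unfolding induced_action_def using z
  proof (simp, intro the_equality)
    show "w \<in> carrier A \<and> (\<exists>h\<in>carrier G. p h = p g \<and> f w = h \<otimes>\<^bsub>G\<^esub> f z \<otimes>\<^bsub>G\<^esub> inv\<^bsub>G\<^esub> h)"
      using w g by blast
  next
    fix v assume v: "v \<in> carrier A \<and> (\<exists>h\<in>carrier G. p h = p g \<and> f v = h \<otimes>\<^bsub>G\<^esub> f z \<otimes>\<^bsub>G\<^esub> inv\<^bsub>G\<^esub> h)"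
    then have "f v = f w" using conj_eq_of_same_image[OF s ab z _ g] w by metis
    then show "v = w" using inj v w by (auto simp: inj_on_def)
  qed
  with w show "induced_action A G f p (p g) z \<in> carrier A"
    "f (induced_action A G f p (p g) z) = g \<otimes>\<^bsub>G\<^esub> f z \<otimes>\<^bsub>G\<^esub> inv\<^bsub>G\<^esub> g" by auto
qed

lemma induced_action_is_action:
  assumes s: "short_exact_sequence A G Q f p" and ab: "comm_group A"
  shows "group_action Q (carrier A) (induced_action A G f p)"
proof -
  let ?r = "induced_action A G f p"
  interpret group_hom G Q p
    using s by (auto simp: short_exact_sequence_def epi_def intro!: group_hom.intro group_hom_axioms.intro)
  have fh: "f \<in> hom A G" and inj: "inj_on f (carrier A)"
    using s by (auto simp: short_exact_sequence_def mon_def)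
  have [simp]: "f z \<in> carrier G" if "z \<in> carrier A" for z using fh that by (auto simp: hom_def)
  have surj: "\<exists>g\<in>carrier G. p g = \<sigma>" if "\<sigma> \<in> carrier Q" for \<sigma>
  proof -
    have "\<sigma> \<in> p ` carrier G" using s that by (simp add: short_exact_sequence_def epi_def)
    then show ?thesis by blast
  qed
  have cl: "?r \<sigma> z \<in> carrier A" if "\<sigma> \<in> carrier Q" "z \<in> carrier A" for \<sigma> z
    using surj[OF that(1)] induced_action_eq(1)[OF s ab that(2)] by blast
  have mult: "?r (\<sigma> \<otimes>\<^bsub>Q\<^esub> \<tau>) z = ?r \<sigma> (?r \<tau> z)"
    if st: "\<sigma> \<in> carrier Q" "\<tau> \<in> carrier Q" and z: "z \<in> carrier A" for \<sigma> \<tau> z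
  proof -
    obtain g h where g: "g \<in> carrier G" "p g = \<sigma>" and h: "h \<in> carrier G" "p h = \<tau>"
      using surj st by meson
    have gh: "g \<otimes>\<^bsub>G\<^esub> h \<in> carrier G" "p (g \<otimes>\<^bsub>G\<^esub> h) = \<sigma> \<otimes>\<^bsub>Q\<^esub> \<tau>" using g h by auto
    have "f (?r (\<sigma> \<otimes>\<^bsub>Q\<^esub> \<tau>) z) = f (?r \<sigma> (?r \<tau> z))"
      using induced_action_eq(2)[OF s ab z gh(1)] induced_action_eq(2)[OF s ab z h(1)]
        induced_action_eq(2)[OF s ab cl[OF st(2) z] g(1)] g h gh z
      by (simp add: G.m_assoc G.inv_mult_group)
    then show ?thesis using inj cl st z by (simp add: inj_on_def)
  qed
  have one: "?r \<one>\<^bsub>Q\<^esub> z = z" if z: "z \<in> carrier A" for z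
    using induced_action_eq[OF s ab z G.one_closed] inj z by (auto simp: inj_on_def)
  have bij: "?r \<sigma> \<in> Bij (carrier A)" if st: "\<sigma> \<in> carrier Q" for \<sigma>
  proof -
    have "bij_betw (?r \<sigma>) (carrier A) (carrier A)"
      by (rule bij_betw_byWitness[where f' = "?r (inv\<^bsub>Q\<^esub> \<sigma>)"])
         (use st cl mult[symmetric] one in auto)
    then show ?thesis by (simp add: Bij_def induced_action_def)
  qed
  have "?r \<in> hom Q (BijGroup (carrier A))"
  proof (rule homI)
    fix \<sigma> \<tau> assume st: "\<sigma> \<in> carrier Q" "\<tau> \<in> carrier Q"
    have "?r (\<sigma> \<otimes>\<^bsub>Q\<^esub> \<tau>) = compose (carrier A) (?r \<sigma>) (?r \<tau>)"
      by (rule extensionalityI[of _ "carrier A"])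
         (use st mult in \<open>auto simp: compose_def induced_action_def\<close>)
    then show "?r (\<sigma> \<otimes>\<^bsub>Q\<^esub> \<tau>) = ?r \<sigma> \<otimes>\<^bsub>BijGroup (carrier A)\<^esub> ?r \<tau>"
      using bij st by (simp add: BijGroup_def)
  qed (use bij in \<open>simp add: BijGroup_def\<close>)
  then show ?thesis
    by (simp add: group_action_def group_hom_def group_hom_axioms_def group_BijGroup)
qed

lemma index_perm_eq:
  assumes s: "short_exact_sequence (free_Abelian_group X) G Q f p"
    and pb: "\<And>\<sigma>. \<sigma> \<in> carrier Q \<Longrightarrow>
      induced_action (free_Abelian_group X) G f p \<sigma> ` (frag_of ` X) = frag_of ` X"
    and g: "g \<in> carrier G" and i: "i \<in> X"
  shows "index_perm X G Q f p (inv\<^bsub>Q\<^esub> (p g)) i \<in> X"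
    and "g \<otimes>\<^bsub>G\<^esub> f (frag_of i) \<otimes>\<^bsub>G\<^esub> inv\<^bsub>G\<^esub> g = f (frag_of (index_perm X G Q f p (inv\<^bsub>Q\<^esub> (p g)) i))"
proof -
  let ?A = "free_Abelian_group X"
  interpret group_hom G Q p
    using s by (auto simp: short_exact_sequence_def epi_def intro!: group_hom.intro group_hom_axioms.intro)
  have inj: "inj_on f (carrier ?A)" using s by (auto simp: short_exact_sequence_def mon_def)
  note ab = abelian_free_Abelian_group[of X]
  have i': "frag_of i \<in> carrier ?A" using i by simp
  obtain j where j: "j \<in> X" "induced_action ?A G f p (p g) (frag_of i) = frag_of j"
    using pb[of "p g"] g i by (metis (no_types, lifting) hom_closed image_iff)
  have eq: "g \<otimes>\<^bsub>G\<^esub> f (frag_of i) \<otimes>\<^bsub>G\<^esub> inv\<^bsub>G\<^esub> g = f (frag_of j)"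
    using induced_action_eq(2)[OF s ab i' g] j by simp
  have "index_perm X G Q f p (inv\<^bsub>Q\<^esub> (p g)) i = j"
    unfolding index_perm_def
  proof (rule the_equality)
    show "j \<in> X \<and> (\<exists>h\<in>carrier G. inv\<^bsub>Q\<^esub> (p g) = inv\<^bsub>Q\<^esub> (p h) \<and>
        h \<otimes>\<^bsub>G\<^esub> f (frag_of i) \<otimes>\<^bsub>G\<^esub> inv\<^bsub>G\<^esub> h = f (frag_of j))"
      using j eq g by blast
  next
    fix k assume "k \<in> X \<and> (\<exists>h\<in>carrier G. inv\<^bsub>Q\<^esub> (p g) = inv\<^bsub>Q\<^esub> (p h) \<and>
        h \<otimes>\<^bsub>G\<^esub> f (frag_of i) \<otimes>\<^bsub>G\<^esub> inv\<^bsub>G\<^esub> h = f (frag_of k))"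
    then obtain h where k: "k \<in> X" and h: "h \<in> carrier G" "inv\<^bsub>Q\<^esub> (p g) = inv\<^bsub>Q\<^esub> (p h)"
        "h \<otimes>\<^bsub>G\<^esub> f (frag_of i) \<otimes>\<^bsub>G\<^esub> inv\<^bsub>G\<^esub> h = f (frag_of k)" by blast
    have "p g = p h" using h g by (metis H.inv_inv hom_closed)
    then have "f (frag_of j) = f (frag_of k)"
      using conj_eq_of_same_image[OF s ab i' g h(1)] eq h(3) by simp
    then have "frag_of j = frag_of k"
      using inj j k by (auto simp: inj_on_def)
    then show "k = j" by (simp add: frag_of_eq)
  qed
  with j eq show "index_perm X G Q f p (inv\<^bsub>Q\<^esub> (p g)) i \<in> X"
    "g \<otimes>\<^bsub>G\<^esub> f (frag_of i) \<otimes>\<^bsub>G\<^esub> inv\<^bsub>G\<^esub> g = f (frag_of (index_perm X G Q f p (inv\<^bsub>Q\<^esub> (p g)) i))"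
    by auto
qed

lemma index_orbit_eq_conjugation_orbit:
  assumes s: "short_exact_sequence (free_Abelian_group X) G Q f p"
    and pb: "\<And>\<sigma>. \<sigma> \<in> carrier Q \<Longrightarrow>
      induced_action (free_Abelian_group X) G f p \<sigma> ` (frag_of ` X) = frag_of ` X"
    and al: "\<alpha> \<in> carrier G" and i: "i \<in> X"
  shows "index_orbit X G Q f p (inv\<^bsub>Q\<^esub> (p \<alpha>)) i =
    {j \<in> X. \<exists>g \<in> generate G {\<alpha>}. g \<otimes>\<^bsub>G\<^esub> f (frag_of i) \<otimes>\<^bsub>G\<^esub> inv\<^bsub>G\<^esub> g = f (frag_of j)}"
proof -
  interpret group_hom G Q p
    using s by (auto simp: short_exact_sequence_def epi_def intro!: group_hom.intro group_hom_axioms.intro)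
  have inj: "inj_on f (carrier (free_Abelian_group X))"
    using s by (auto simp: short_exact_sequence_def mon_def)
  have pw: "inv\<^bsub>Q\<^esub> (p \<alpha>) [^]\<^bsub>Q\<^esub> k = inv\<^bsub>Q\<^esub> (p (\<alpha> [^]\<^bsub>G\<^esub> k))" for k :: int
    using al by (simp add: hom_int_pow H.int_pow_inv)
  have gen: "generate G {\<alpha>} = {\<alpha> [^]\<^bsub>G\<^esub> k | k :: int. True}"
    using G.generate_pow[OF al] by auto
  have frag_iff: "f (frag_of j) = f (frag_of k) \<longleftrightarrow> j = k"
    if "j \<in> X" "k \<in> X" for j k
    using inj_on_eq_iff[OF inj, of "frag_of j" "frag_of k"] that by (simp add: frag_of_eq)
  have cl: "\<alpha> [^]\<^bsub>G\<^esub> k \<in> carrier G" for k :: int using al by simp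
  note e = index_perm_eq[OF s pb cl i]
  show ?thesis
  proof (rule Set.set_eqI)
    fix j
    have "j \<in> index_orbit X G Q f p (inv\<^bsub>Q\<^esub> (p \<alpha>)) i \<longleftrightarrow>
        (\<exists>k::int. j = index_perm X G Q f p (inv\<^bsub>Q\<^esub> (p (\<alpha> [^]\<^bsub>G\<^esub> k))) i)"
      unfolding index_orbit_def pw by blast
    also have "\<dots> \<longleftrightarrow> j \<in> X \<and> (\<exists>k::int.
        f (frag_of (index_perm X G Q f p (inv\<^bsub>Q\<^esub> (p (\<alpha> [^]\<^bsub>G\<^esub> k))) i)) = f (frag_of j))"
      using e(1) frag_iff by blast
    also have "\<dots> \<longleftrightarrow> j \<in> X \<and> (\<exists>k::int. \<alpha> [^]\<^bsub>G\<^esub> k \<otimes>\<^bsub>G\<^esub> f (frag_of i) \<otimes>\<^bsub>G\<^esub> inv\<^bsub>G\<^esub> (\<alpha> [^]\<^bsub>G\<^esub> k) = f (frag_of j))"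
      by (simp only: e(2))
    finally show "j \<in> index_orbit X G Q f p (inv\<^bsub>Q\<^esub> (p \<alpha>)) i \<longleftrightarrow>
        j \<in> {j \<in> X. \<exists>g \<in> generate G {\<alpha>}. g \<otimes>\<^bsub>G\<^esub> f (frag_of i) \<otimes>\<^bsub>G\<^esub> inv\<^bsub>G\<^esub> g = f (frag_of j)}"
      unfolding gen by blast
  qed
qed

end

theory Submission
  imports Defs
begin

text \<open>
  Let \<open>A = \<int>X\<close> and let \<open>c\<close> be the automorphism of \<open>A\<close> given by conjugation with \<open>\<alpha>\<close>.  Since \<open>A\<close>
  is abelian, conjugating \<open>u\<alpha>\<close> by \<open>w \<in> A\<close> gives \<open>w u \<alpha> w\<^sup>-\<^sup>1 = u \<cdot> (w \<cdot> c(w)\<^sup>-\<^sup>1) \<cdot> \<alpha>\<close>.  Hence the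
  conjugacy class of \<open>u\<alpha>\<close> depends only on the class of \<open>u\<close> modulo the subgroup
  \<open>D = {w \<cdot> c(w)\<^sup>-\<^sup>1 | w \<in> A}\<close> (lemma \<open>conjugate_in_coboundary_coset\<close>); the quotient \<open>A / D\<close> is the
  group of coinvariants of \<open>A\<close> under \<open>\<langle>\<alpha>\<rangle>\<close>.

  In the coinvariants every element is identified with all its conjugates under powers of
  \<open>\<alpha>\<close> (lemma \<open>conjugation_trivial_mod_coboundaries\<close>), so basis elements in one orbit
  coincide.  In \<open>\<Prod> \<lambda>\<^sub>i\<^bsup>a\<^sub>i\<^esup>\<close> each \<open>\<lambda>\<^sub>i\<close> may therefore be replaced by the
  representative of its orbit in \<open>T\<close>, and the exponents over an orbit add up
  (lemma \<open>collect_exponents_mod_subgroup\<close>).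
\<close>

lemma (in group) cancel_inv_left:
  assumes "x \<in> carrier G" and "y \<in> carrier G"
  shows "x \<otimes> (inv x \<otimes> y) = y" and "inv x \<otimes> (x \<otimes> y) = y"
  using assms by (simp_all flip: m_assoc)

section \<open>Coboundaries of an endomorphism\<close>

text \<open>
  The image of \<open>1 - c\<close>, in multiplicative notation.  When \<open>c\<close> is the action of a generator of a
  cyclic group, the quotient by this subgroup is the group of coinvariants.
\<close>

definition coboundaries :: "('a, 'm) monoid_scheme \<Rightarrow> ('a \<Rightarrow> 'a) \<Rightarrow> 'a set" where
  "coboundaries A c = (\<lambda>w. w \<otimes>\<^bsub>A\<^esub> inv\<^bsub>A\<^esub> (c w)) ` carrier A"

lemma subgroup_coboundaries:
  assumes "comm_group A" and "c \<in> hom A A"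
  shows "subgroup (coboundaries A c) A"
proof -
  interpret comm_group A by (rule assms(1))
  have [simp]: "c w \<in> carrier A" if "w \<in> carrier A" for w
    using assms(2) that by (rule hom_in_carrier)
  have "(\<lambda>w. w \<otimes>\<^bsub>A\<^esub> inv\<^bsub>A\<^esub> (c w)) \<in> hom A A"
  proof (rule homI)
    fix x y assume "x \<in> carrier A" "y \<in> carrier A"
    then show "x \<otimes>\<^bsub>A\<^esub> y \<otimes>\<^bsub>A\<^esub> inv\<^bsub>A\<^esub> (c (x \<otimes>\<^bsub>A\<^esub> y)) =
        x \<otimes>\<^bsub>A\<^esub> inv\<^bsub>A\<^esub> (c x) \<otimes>\<^bsub>A\<^esub> (y \<otimes>\<^bsub>A\<^esub> inv\<^bsub>A\<^esub> (c y))"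
      by (simp add: Group.hom_mult[OF assms(2)] inv_mult m_ac)
  qed simp
  then interpret d: group_hom A A "\<lambda>w. w \<otimes>\<^bsub>A\<^esub> inv\<^bsub>A\<^esub> (c w)"
    by unfold_locales
  show ?thesis
    unfolding coboundaries_def by (rule d.img_is_subgroup)
qed

section \<open>Coboundaries of conjugation\<close>

lemma induced_action_hom:
  assumes s: "short_exact_sequence A G Q f p" and ab: "comm_group A" and g: "g \<in> carrier G"
  shows "induced_action A G f p (p g) \<in> hom A A"
proof (rule homI)
  interpret A: comm_group A by (rule ab)
  interpret G: group G using s by (simp add: short_exact_sequence_def)
  have fh: "f \<in> hom A G" and inj: "inj_on f (carrier A)"
    using s by (auto simp: short_exact_sequence_def mon_def)
  note cl = induced_action_eq(1)[OF s ab _ g] and eq = induced_action_eq(2)[OF s ab _ g]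
  fix x y assume xy: "x \<in> carrier A" "y \<in> carrier A"
  have fxy: "f x \<in> carrier G" "f y \<in> carrier G" using fh xy by (auto dest: hom_in_carrier)
  have "f (induced_action A G f p (p g) (x \<otimes>\<^bsub>A\<^esub> y)) =
      f (induced_action A G f p (p g) x \<otimes>\<^bsub>A\<^esub> induced_action A G f p (p g) y)"
    using xy g fxy by (simp add: eq cl Group.hom_mult[OF fh] G.m_assoc G.cancel_inv_left)
  then show "induced_action A G f p (p g) (x \<otimes>\<^bsub>A\<^esub> y) =
      induced_action A G f p (p g) x \<otimes>\<^bsub>A\<^esub> induced_action A G f p (p g) y"
    using inj xy cl by (simp add: inj_on_def)
qed (rule induced_action_eq(1)[OF s ab _ g])

text \<open>
  Conjugating \<open>f u \<otimes> \<alpha>\<close> by an element \<open>f w\<close> and moving \<open>inv (f w)\<close> to the left past \<open>\<alpha>\<close> turns it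
  into the inverse of the conjugate of \<open>f w\<close> by \<open>\<alpha>\<close>; so \<open>u\<close> changes by exactly a coboundary,
  and every coboundary arises in this way.
\<close>

lemma conjugate_in_coboundary_coset:
  assumes s: "short_exact_sequence A G Q f p" and ab: "comm_group A"
    and al: "\<alpha> \<in> carrier G" and u: "u \<in> carrier A"
    and d: "d \<in> coboundaries A (induced_action A G f p (p \<alpha>))"
  shows "conjugate_in G (f (d \<otimes>\<^bsub>A\<^esub> u) \<otimes>\<^bsub>G\<^esub> \<alpha>) (f u \<otimes>\<^bsub>G\<^esub> \<alpha>)"
proof -
  interpret A: comm_group A by (rule ab)
  interpret G: group G using s by (simp add: short_exact_sequence_def)
  have fh: "f \<in> hom A G" using s by (auto simp: short_exact_sequence_def mon_def)
  interpret f: group_hom A G f by unfold_locales (rule fh)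
  obtain w where w: "w \<in> carrier A" and dw: "d = w \<otimes>\<^bsub>A\<^esub> inv\<^bsub>A\<^esub> (induced_action A G f p (p \<alpha>) w)"
    using d unfolding coboundaries_def by blast
  let ?cw = "induced_action A G f p (p \<alpha>) w"
  have cw: "?cw \<in> carrier A" "f ?cw = \<alpha> \<otimes>\<^bsub>G\<^esub> f w \<otimes>\<^bsub>G\<^esub> inv\<^bsub>G\<^esub> \<alpha>"
    using induced_action_eq[OF s ab w al] by auto
  \<comment> \<open>Conjugation by \<open>w\<close> would multiply by \<open>d\<close>, so its inverse removes \<open>d\<close>.\<close>
  have "d \<otimes>\<^bsub>A\<^esub> u = w \<otimes>\<^bsub>A\<^esub> (u \<otimes>\<^bsub>A\<^esub> inv\<^bsub>A\<^esub> ?cw)"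
    unfolding dw using w u cw(1) by (simp add: A.m_ac)
  then have "inv\<^bsub>A\<^esub> w \<otimes>\<^bsub>A\<^esub> (d \<otimes>\<^bsub>A\<^esub> u) = u \<otimes>\<^bsub>A\<^esub> inv\<^bsub>A\<^esub> ?cw"
    using w u cw(1) by (simp add: A.cancel_inv_left)
  then have "f (inv\<^bsub>A\<^esub> w) \<otimes>\<^bsub>G\<^esub> f (d \<otimes>\<^bsub>A\<^esub> u) = f u \<otimes>\<^bsub>G\<^esub> inv\<^bsub>G\<^esub> (f ?cw)"
    using w u cw(1) by (simp add: dw flip: f.hom_mult f.hom_inv)
  then have "f (inv\<^bsub>A\<^esub> w) \<otimes>\<^bsub>G\<^esub> (f (d \<otimes>\<^bsub>A\<^esub> u) \<otimes>\<^bsub>G\<^esub> \<alpha>) \<otimes>\<^bsub>G\<^esub> inv\<^bsub>G\<^esub> (f (inv\<^bsub>A\<^esub> w)) =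
      f u \<otimes>\<^bsub>G\<^esub> inv\<^bsub>G\<^esub> (f ?cw) \<otimes>\<^bsub>G\<^esub> \<alpha> \<otimes>\<^bsub>G\<^esub> f w"
    using w u cw(1) al by (simp add: dw flip: G.m_assoc)
  also have "\<dots> = f u \<otimes>\<^bsub>G\<^esub> \<alpha>"
    using w u al by (simp add: cw(2) G.inv_mult_group G.m_assoc G.cancel_inv_left)
  finally show ?thesis
    unfolding conjugate_in_def using f.hom_closed[OF A.inv_closed[OF w]] by (rule bexI)
qed

text \<open>
  For \<open>g = \<alpha>\<close> the quotient of \<open>c y\<close> by \<open>y\<close> is the inverse of the coboundary of \<open>y\<close>.  The general
  case follows by inducting on the generation of \<open>g\<close>: the quotients belonging to the
  factors of a product multiply, through the intermediate conjugate.
\<close>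

lemma conjugation_trivial_mod_coboundaries:
  assumes s: "short_exact_sequence A G Q f p" and ab: "comm_group A" and al: "\<alpha> \<in> carrier G"
    and g: "g \<in> generate G {\<alpha>}"
    and "y \<in> carrier A" "z \<in> carrier A" "g \<otimes>\<^bsub>G\<^esub> f y \<otimes>\<^bsub>G\<^esub> inv\<^bsub>G\<^esub> g = f z"
  shows "z \<otimes>\<^bsub>A\<^esub> inv\<^bsub>A\<^esub> y \<in> coboundaries A (induced_action A G f p (p \<alpha>))"
  using g assms(5-7)
proof (induction arbitrary: y z)
  let ?c = "induced_action A G f p (p \<alpha>)"
  interpret A: comm_group A by (rule ab)
  interpret G: group G using s by (simp add: short_exact_sequence_def)
  have fh: "f \<in> hom A G" and inj: "inj_on f (carrier A)"
    using s by (auto simp: short_exact_sequence_def mon_def)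
  have fcl: "f x \<in> carrier G" if "x \<in> carrier A" for x using fh that by (rule hom_in_carrier)
  interpret D: subgroup "coboundaries A ?c" A
    by (rule subgroup_coboundaries[OF ab induced_action_hom[OF s ab al]])
  have D: "x \<otimes>\<^bsub>A\<^esub> inv\<^bsub>A\<^esub> (?c x) \<in> coboundaries A ?c" if "x \<in> carrier A" for x
    unfolding coboundaries_def using that by blast
  note c = induced_action_eq[OF s ab _ al]
  have c_eqI: "?c x = x'" if "x \<in> carrier A" "x' \<in> carrier A"
    "\<alpha> \<otimes>\<^bsub>G\<^esub> f x \<otimes>\<^bsub>G\<^esub> inv\<^bsub>G\<^esub> \<alpha> = f x'" for x x'
    using inj c[OF that(1)] that by (simp add: inj_on_def)
  {
    case one
    then have "z = y" using inj fcl by (simp add: inj_on_def)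
    then show ?case using one by simp
  next
    case (incl h)
    then have "?c y = z" by (intro c_eqI) auto
    with incl have "z \<otimes>\<^bsub>A\<^esub> inv\<^bsub>A\<^esub> y = inv\<^bsub>A\<^esub> (y \<otimes>\<^bsub>A\<^esub> inv\<^bsub>A\<^esub> (?c y))"
      by (simp add: A.inv_mult A.m_comm)
    then show ?case using D incl by simp
  next
    case (inv h)
    then have "f z = inv\<^bsub>G\<^esub> \<alpha> \<otimes>\<^bsub>G\<^esub> f y \<otimes>\<^bsub>G\<^esub> \<alpha>" using al by simp
    then have "\<alpha> \<otimes>\<^bsub>G\<^esub> f z \<otimes>\<^bsub>G\<^esub> inv\<^bsub>G\<^esub> \<alpha> = f y"
      using al fcl[OF inv(2)] by (simp add: G.m_assoc G.cancel_inv_left)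
    then have "?c z = y" using inv by (intro c_eqI) auto
    then show ?case using D inv by blast
  next
    case (eng h1 h2)
    have h: "h1 \<in> carrier G" "h2 \<in> carrier G"
      using eng(1,2) G.generate_in_carrier[of "{\<alpha>}"] al by auto
    obtain x where x: "x \<in> carrier A" "f x = h2 \<otimes>\<^bsub>G\<^esub> f y \<otimes>\<^bsub>G\<^esub> inv\<^bsub>G\<^esub> h2"
      using conj_closed_kernel[OF s eng(5) h(2)] by blast
    have "h1 \<otimes>\<^bsub>G\<^esub> f x \<otimes>\<^bsub>G\<^esub> inv\<^bsub>G\<^esub> h1 = f z"
      unfolding x(2) eng(7)[symmetric] using h fcl[OF eng(5)] by (simp add: G.m_assoc G.inv_mult_group)
    with eng.prems x have "(z \<otimes>\<^bsub>A\<^esub> inv\<^bsub>A\<^esub> x) \<otimes>\<^bsub>A\<^esub> (x \<otimes>\<^bsub>A\<^esub> inv\<^bsub>A\<^esub> y) \<in> coboundaries A ?c"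
      by (intro D.m_closed eng.IH) simp_all
    also have "(z \<otimes>\<^bsub>A\<^esub> inv\<^bsub>A\<^esub> x) \<otimes>\<^bsub>A\<^esub> (x \<otimes>\<^bsub>A\<^esub> inv\<^bsub>A\<^esub> y) = z \<otimes>\<^bsub>A\<^esub> inv\<^bsub>A\<^esub> y"
      using eng(5,6) x by (simp add: A.m_assoc A.cancel_inv_left)
    finally show ?case .
  }
qed

section \<open>Collecting exponents along orbits\<close>

lemma index_orbit_sym:
  assumes s: "short_exact_sequence (free_Abelian_group X) G Q f p"
    and pb: "\<And>\<sigma>. \<sigma> \<in> carrier Q \<Longrightarrow>
      induced_action (free_Abelian_group X) G f p \<sigma> ` (frag_of ` X) = frag_of ` X"
    and al: "\<alpha> \<in> carrier G" and i: "i \<in> X"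
    and j: "j \<in> index_orbit X G Q f p (inv\<^bsub>Q\<^esub> (p \<alpha>)) i"
  shows "i \<in> index_orbit X G Q f p (inv\<^bsub>Q\<^esub> (p \<alpha>)) j"
proof -
  interpret G: group G using s by (simp add: short_exact_sequence_def)
  have orb: "index_orbit X G Q f p (inv\<^bsub>Q\<^esub> (p \<alpha>)) k =
      {j \<in> X. \<exists>g \<in> generate G {\<alpha>}. g \<otimes>\<^bsub>G\<^esub> f (frag_of k) \<otimes>\<^bsub>G\<^esub> inv\<^bsub>G\<^esub> g = f (frag_of j)}"
    if "k \<in> X" for k
    using index_orbit_eq_conjugation_orbit[OF s pb al that] .
  obtain g where jX: "j \<in> X" and g: "g \<in> generate G {\<alpha>}"
    and eq: "g \<otimes>\<^bsub>G\<^esub> f (frag_of i) \<otimes>\<^bsub>G\<^esub> inv\<^bsub>G\<^esub> g = f (frag_of j)"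
    using j unfolding orb[OF i] by blast
  have "f (frag_of i) \<in> carrier G"
    using s i hom_in_carrier[of f "free_Abelian_group X" G "frag_of i"]
    by (simp add: short_exact_sequence_def mon_def)
  moreover have "g \<in> carrier G" "inv\<^bsub>G\<^esub> g \<in> generate G {\<alpha>}"
    using g al G.generate_in_carrier[of "{\<alpha>}"] G.generate_m_inv_closed[of "{\<alpha>}"] by auto
  moreover from this have "inv\<^bsub>G\<^esub> g \<otimes>\<^bsub>G\<^esub> f (frag_of j) \<otimes>\<^bsub>G\<^esub> inv\<^bsub>G\<^esub> (inv\<^bsub>G\<^esub> g) = f (frag_of i)"
    unfolding eq[symmetric] using \<open>f (frag_of i) \<in> carrier G\<close>
    by (simp add: G.m_assoc G.cancel_inv_left)
  ultimately show ?thesis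
    unfolding orb[OF jX] using i by blast
qed

text \<open>
  Symmetry of the relation \<open>j \<in> orb i\<close> makes the sets \<open>orb t\<close>, for \<open>t \<in> T\<close>, a partition of \<open>X\<close>:
  each \<open>i \<in> X\<close> lies in \<open>orb t\<close> precisely for the \<open>t \<in> T\<close> that lie in \<open>orb i\<close>, and there is one
  such \<open>t\<close>.
\<close>

lemma sum_over_transversal:
  fixes h :: "'x \<Rightarrow> 'b::comm_monoid_add"
  assumes "finite X" and T: "transversal X orb T"
    and sub: "\<And>i. i \<in> X \<Longrightarrow> orb i \<subseteq> X"
    and sym: "\<And>i j. i \<in> X \<Longrightarrow> j \<in> orb i \<Longrightarrow> i \<in> orb j"
  shows "(\<Sum>t\<in>T. \<Sum>r\<in>orb t. h r) = (\<Sum>r\<in>X. h r)"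
proof -
  have TX: "T \<subseteq> X" and ex1: "\<forall>i\<in>X. \<exists>!t. t \<in> T \<inter> orb i"
    using T unfolding transversal_def by (blast, rule conjunct2)
  have "(\<Sum>r\<in>X. h r) = (\<Sum>r\<in>(\<Union>t\<in>T. orb t). h r)"
  proof (rule arg_cong[where f = "sum h"])
    show "X = (\<Union>t\<in>T. orb t)"
    proof
      show "X \<subseteq> (\<Union>t\<in>T. orb t)"
      proof
        fix i assume "i \<in> X"
        then obtain t where "t \<in> T" "t \<in> orb i" using ex1 by (meson IntE)
        then show "i \<in> (\<Union>t\<in>T. orb t)" using sym[OF \<open>i \<in> X\<close>] by blast
      qed
      show "(\<Union>t\<in>T. orb t) \<subseteq> X"
        using TX sub by (meson UN_least subsetD)
    qed
  qed
  also have "\<dots> = (\<Sum>t\<in>T. \<Sum>r\<in>orb t. h r)"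
  proof (rule sum.UNION_disjoint)
    show "finite T" using TX \<open>finite X\<close> by (rule finite_subset)
    show "\<forall>t\<in>T. finite (orb t)" using TX sub \<open>finite X\<close> by (meson finite_subset subsetD)
    show "\<forall>t\<in>T. \<forall>t'\<in>T. t \<noteq> t' \<longrightarrow> orb t \<inter> orb t' = {}"
    proof (intro ballI impI, rule ccontr)
      fix t t' assume t: "t \<in> T" "t' \<in> T" "t \<noteq> t'" and "orb t \<inter> orb t' \<noteq> {}"
      then obtain i where i: "i \<in> orb t" "i \<in> orb t'" by blast
      then have "i \<in> X" using sub[of t] TX t by blast
      with ex1 have "\<exists>!t. t \<in> T \<inter> orb i" by (rule bspec)
      moreover have "t \<in> T \<inter> orb i" "t' \<in> T \<inter> orb i"
        using sym[of t i] sym[of t' i] t i TX by auto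
      ultimately show False using t(3) by (elim ex1E) metis
    qed
  qed
  finally show ?thesis by simp
qed

lemma sum_in_subgroup_free_Abelian_group:
  assumes D: "subgroup D (free_Abelian_group X)" and "\<And>i. i \<in> I \<Longrightarrow> h i \<in> D"
  shows "(\<Sum>i\<in>I. h i) \<in> D"
  using assms(2)
proof (induction I rule: infinite_finite_induct)
  case (insert i I)
  then show ?case using subgroup.m_closed[OF D, of "h i" "sum h I"] by simp
qed (use subgroup.one_closed[OF D] in auto)

lemma frag_cmul_in_subgroup_free_Abelian_group:
  assumes D: "subgroup D (free_Abelian_group X)" and "d \<in> D"
  shows "frag_cmul k d \<in> D"
proof -
  interpret comm_group "free_Abelian_group X" by (rule abelian_free_Abelian_group)
  have "d [^]\<^bsub>free_Abelian_group X\<^esub> k = frag_cmul k d"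
    using subgroup.mem_carrier[OF D \<open>d \<in> D\<close>] by simp
  with subgroup_int_pow_closed[OF D \<open>d \<in> D\<close>, of k] show ?thesis by simp
qed

lemma finprod_free_Abelian_group:
  assumes "h \<in> I \<rightarrow> carrier (free_Abelian_group X)"
  shows "finprod (free_Abelian_group X) h I = sum h I"
proof -
  interpret comm_group "free_Abelian_group X" by (rule abelian_free_Abelian_group)
  show ?thesis
    using assms
  proof (induction I rule: infinite_finite_induct)
    case (insert i I)
    then show ?case by (simp del: carrier_free_Abelian_group_iff)
  qed simp_all
qed

text \<open>
  After the first sum is split along the orbits, the difference of the two sums is the sum of
  all \<open>a r (\<lambda>\<^sub>r - \<lambda>\<^sub>t)\<close> with \<open>t \<in> T\<close> and \<open>r \<in> orb t\<close>, and each of these terms lies in \<open>D\<close>.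
\<close>

lemma collect_exponents_mod_subgroup:
  assumes "finite X" and T: "transversal X orb T"
    and sub: "\<And>i. i \<in> X \<Longrightarrow> orb i \<subseteq> X"
    and sym: "\<And>i j. i \<in> X \<Longrightarrow> j \<in> orb i \<Longrightarrow> i \<in> orb j"
    and D: "subgroup D (free_Abelian_group X)"
    and diff: "\<And>i j. i \<in> X \<Longrightarrow> j \<in> orb i \<Longrightarrow> frag_of j - frag_of i \<in> D"
  shows "(\<Sum>i\<in>X. frag_cmul (a i) (frag_of i)) -
      (\<Sum>t\<in>T. frag_cmul (\<Sum>r\<in>orb t. a r) (frag_of t)) \<in> D"
proof -
  have cmul_sum: "frag_cmul (sum a R) x = (\<Sum>r\<in>R. frag_cmul (a r) x)" for R and x :: "'a \<Rightarrow>\<^sub>0 int"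
    by (induction R rule: infinite_finite_induct) (auto simp: frag_cmul_distrib)
  have cmul_diff: "frag_cmul k (x - y) = frag_cmul k x - frag_cmul k y" for k and x y :: "'a \<Rightarrow>\<^sub>0 int"
    using frag_cmul_distrib2[of k "x - y" y] by simp
  have "(\<Sum>t\<in>T. \<Sum>r\<in>orb t. frag_cmul (a r) (frag_of r - frag_of t)) \<in> D"
    using T diff
    by (intro sum_in_subgroup_free_Abelian_group[OF D] frag_cmul_in_subgroup_free_Abelian_group[OF D])
      (auto simp: transversal_def)
  also have "(\<Sum>t\<in>T. \<Sum>r\<in>orb t. frag_cmul (a r) (frag_of r - frag_of t)) =
      (\<Sum>t\<in>T. \<Sum>r\<in>orb t. frag_cmul (a r) (frag_of r)) -
      (\<Sum>t\<in>T. frag_cmul (\<Sum>r\<in>orb t. a r) (frag_of t))"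
    by (simp add: cmul_diff sum_subtractf cmul_sum)
  also have "(\<Sum>t\<in>T. \<Sum>r\<in>orb t. frag_cmul (a r) (frag_of r)) =
      (\<Sum>i\<in>X. frag_cmul (a i) (frag_of i))"
    by (rule sum_over_transversal[OF assms(1-4)])
  finally show ?thesis .
qed

section \<open>The conjugacy theorem\<close>

theorem theorem2p3:
  fixes X :: "'x set" and G :: "('g, 'm) monoid_scheme" and n :: nat
    and \<iota> :: "('x \<Rightarrow>\<^sub>0 int) \<Rightarrow> 'g" and \<pi> :: "'g \<Rightarrow> (nat \<Rightarrow> nat)"
    and \<alpha> :: 'g and \<theta> :: "nat \<Rightarrow> nat" and T :: "'x set" and a :: "'x \<Rightarrow> int"
  assumes "finite X"
    and "short_exact_sequence (free_Abelian_group X) G (sym_group n) \<iota> \<pi>"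
    and "faithful_action (sym_group n) (carrier (free_Abelian_group X))
           (induced_action (free_Abelian_group X) G \<iota> \<pi>)"
    and "\<And>\<sigma>. \<sigma> \<in> carrier (sym_group n) \<Longrightarrow>
           induced_action (free_Abelian_group X) G \<iota> \<pi> \<sigma> ` (frag_of ` X) = frag_of ` X"
    and "\<alpha> \<in> carrier G"
    and "\<theta> = inv\<^bsub>sym_group n\<^esub> (\<pi> \<alpha>)"
    and "transversal X (index_orbit X G (sym_group n) \<iota> \<pi> \<theta>) T"
  shows "conjugate_in G
    (\<iota> (\<Otimes>\<^bsub>free_Abelian_group X\<^esub>i\<in>X. frag_of i [^]\<^bsub>free_Abelian_group X\<^esub> a i) \<otimes>\<^bsub>G\<^esub> \<alpha>)
    (\<iota> (\<Otimes>\<^bsub>free_Abelian_group X\<^esub>i\<in>T. frag_of i [^]\<^bsub>free_Abelian_group X\<^esub>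
           (\<Sum>r \<in> index_orbit X G (sym_group n) \<iota> \<pi> \<theta> i. a r)) \<otimes>\<^bsub>G\<^esub> \<alpha>)"
proof -
  let ?A = "free_Abelian_group X"
  let ?orb = "index_orbit X G (sym_group n) \<iota> \<pi> \<theta>"
  let ?D = "coboundaries ?A (induced_action ?A G \<iota> \<pi> (\<pi> \<alpha>))"
  let ?u = "\<Sum>i\<in>X. frag_cmul (a i) (frag_of i)"
  let ?v = "\<Sum>t\<in>T. frag_cmul (\<Sum>r\<in>?orb t. a r) (frag_of t)"
  note s = assms(2) and pb = assms(4) and al = assms(5)
  note ab = abelian_free_Abelian_group[of X]
  interpret A: comm_group ?A by (rule ab)
  have orb: "?orb k =
      {j \<in> X. \<exists>g \<in> generate G {\<alpha>}. g \<otimes>\<^bsub>G\<^esub> \<iota> (frag_of k) \<otimes>\<^bsub>G\<^esub> inv\<^bsub>G\<^esub> g = \<iota> (frag_of j)}"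
    if "k \<in> X" for k
    unfolding assms(6) using index_orbit_eq_conjugation_orbit[OF s pb al that] .
  have D: "subgroup ?D ?A"
    by (rule subgroup_coboundaries[OF ab induced_action_hom[OF s ab al]])
  have TX: "T \<subseteq> X" using assms(7) by (simp add: transversal_def)
  have diff: "?u - ?v \<in> ?D"
  proof (rule collect_exponents_mod_subgroup[OF assms(1,7) _ _ D])
    show "?orb i \<subseteq> X" if "i \<in> X" for i
      using orb[OF that] by blast
    show "i \<in> ?orb j" if "i \<in> X" "j \<in> ?orb i" for i j
      using index_orbit_sym[OF s pb al] that unfolding assms(6) by blast
    show "frag_of j - frag_of i \<in> ?D" if i: "i \<in> X" and j: "j \<in> ?orb i" for i j
    proof -
      obtain g where "j \<in> X" "g \<in> generate G {\<alpha>}"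
        "g \<otimes>\<^bsub>G\<^esub> \<iota> (frag_of i) \<otimes>\<^bsub>G\<^esub> inv\<^bsub>G\<^esub> g = \<iota> (frag_of j)"
        using j unfolding orb[OF i] by blast
      then show ?thesis
        using conjugation_trivial_mod_coboundaries[OF s ab al, of g "frag_of i" "frag_of j"] i
        by simp
    qed
  qed
  have term_closed: "frag_cmul k (frag_of i) \<in> carrier ?A" if "i \<in> X" for k i
    using A.int_pow_closed[of "frag_of i" k] that by simp
  have u: "(\<Otimes>\<^bsub>?A\<^esub>i\<in>X. frag_of i [^]\<^bsub>?A\<^esub> a i) = ?u"
    using term_closed by (subst finprod_free_Abelian_group) (auto intro!: sum.cong)
  have v: "(\<Otimes>\<^bsub>?A\<^esub>i\<in>T. frag_of i [^]\<^bsub>?A\<^esub> (\<Sum>r\<in>?orb i. a r)) = ?v"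
    using term_closed TX by (subst finprod_free_Abelian_group) (auto intro!: sum.cong)
  have "?v \<in> carrier ?A"
    using term_closed TX by (intro sum_in_subgroup_free_Abelian_group[OF A.subgroup_self]) auto
  from conjugate_in_coboundary_coset[OF s ab al this diff]
  show ?thesis unfolding u v by simp
qed

end
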